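(* For the OWNM problem with arbitrary positive weights, every point, regardless of its weight, is matched by the randomized algorithm Tree-Guided-Matching (\textsc{Tgm}) with probability at least $1/3$. Hence \textsc{Tgm} achieves a strict competitive ratio of at least $1/3$, i.e., $\mathbb{E}[\textsc{Tgm}(I)]\ge\frac13\textsc{OPT}(I)$ for every input $I$.
   Context: Online Weighted Non-Crossing Matching (OWNM): the input is a sequence $p_1,\dots,p_{2n}$ ($n\ge1$) of points in the Euclidean plane in general position, revealed online one at a time; when $p_i$ arrives its weight $w(p_i)>0$ is revealed. Upon arrival of $p_i$ an online algorithm must irrevocably either leave $p_i$ unmatched or match it with a previously arrived, currently unmatched point, subject to the constraint that the straight-line segments joining matched pairs are pairwise non-crossing. The profit is the total weight of matched points, and $\textsc{OPT}(I)=\sum_i w(p_i)$. Algorithm \textsc{Tgm}: it builds a rooted tree on the arrived points and a partition of the plane into convex regions, each with a responsible point. $p_1$ is the root and $p_2$ its child; the line $\overline{p_1p_2}$ splits the plane into two half-planes, and $p_2$ is responsible for both. In general, when $p_i$ arrives in a region $R$ for which $p_j$ is responsible, $p_i$ becomes a child of $p_j$, the line $\overline{p_ip_j}$ divides $R$ into two sub-regions, $p_i$ becomes responsible for both, and $p_j$ is no longer responsible for $R$ (so each node has at most two children). Matching rule: when $p_2$ arrives, it is matched with $p_1$ with probability $1/3$. For $i\ge3$, let $p_j$ be the parent of $p_i$: if $p_j$ is unmatched and $p_i$ is its first child, $p_i$ is matched with $p_j$ with probability $1/2$; if $p_j$ is unmatched and $p_i$ is its second child, $p_i$ is matched with $p_j$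 with probability $1$; otherwise $p_i$ is left unmatched. *)

theory Defs
  imports "HOL-Probability.Probability"
begin

text \<open>
  Arrivals are numbered from 0: the point \<open>p\<^sub>k\<close> of the informal description is the entry with
  index \<open>k - 1\<close> of the input list.  Each entry consists of a point and its weight.
\<close>

type_synonym point = "real ^ 2"
type_synonym input = "(point \<times> real) list"

definition general_position :: "point list \<Rightarrow> bool" where
  "general_position ps \<longleftrightarrow> distinct ps \<and>
     (\<forall>a\<in>set ps. \<forall>b\<in>set ps. \<forall>c\<in>set ps. a \<noteq> b \<and> a \<noteq> c \<and> b \<noteq> c \<longrightarrow> \<not> collinear {a, b, c})"

definition ownm_input :: "input \<Rightarrow> bool" where
  "ownm_input I \<longleftrightarrow> (\<exists>n\<ge>1. length I = 2 * n) \<and> general_position (map fst I) \<and>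
     (\<forall>x\<in>set I. snd x > 0)"

text \<open>
  The outcome of a run is the list of decisions: entry \<open>i\<close> is \<open>Some j\<close> if point \<open>i\<close> was matched
  with point \<open>j\<close> when point \<open>i\<close> arrived, and \<open>None\<close> if it was left unmatched at that time.
\<close>

type_synonym outcome = "nat option list"

definition matched :: "outcome \<Rightarrow> nat \<Rightarrow> bool" where
  "matched ds i \<longleftrightarrow> (i < length ds \<and> ds ! i \<noteq> None) \<or> Some i \<in> set ds"

text \<open>
  Distinct matched pairs have no endpoint in common, so that non-crossing means that the
  closed segments are disjoint.
\<close>

definition feasible :: "input \<Rightarrow> outcome \<Rightarrow> bool" where
  "feasible I ds \<longleftrightarrow> length ds = length I \<and>
     (\<forall>i<length ds. \<forall>j. ds ! i = Some j \<longrightarrow> j < i \<and> \<not> matched (take i ds) j) \<and>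
     (\<forall>i<length ds. \<forall>i'<length ds. \<forall>j j'. i \<noteq> i' \<and> ds ! i = Some j \<and> ds ! i' = Some j' \<longrightarrow>
        closed_segment (fst (I ! i)) (fst (I ! j)) \<inter>
        closed_segment (fst (I ! i')) (fst (I ! j')) = {})"

definition profit :: "input \<Rightarrow> outcome \<Rightarrow> real" where
  "profit I ds = (\<Sum>i | i < length I \<and> matched ds i. snd (I ! i))"

definition opt :: "input \<Rightarrow> real" where
  "opt I = (\<Sum>i<length I. snd (I ! i))"

text \<open>
  A randomized online algorithm sees the input revealed so far (including the current point)
  and its own earlier decisions, and draws the decision for the current point.
\<close>

type_synonym online_alg = "input \<Rightarrow> outcome \<Rightarrow> nat option pmf"

primrec run_steps :: "online_alg \<Rightarrow> input \<Rightarrow> nat \<Rightarrow> outcome pmf" where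
  "run_steps A I 0 = return_pmf []"
| "run_steps A I (Suc i) =
     bind_pmf (run_steps A I i) (\<lambda>ds. map_pmf (\<lambda>d. ds @ [d]) (A (take (Suc i) I) ds))"

definition run :: "online_alg \<Rightarrow> input \<Rightarrow> outcome pmf" where
  "run A I = run_steps A I (length I)"

definition ownm_algorithm :: "online_alg \<Rightarrow> bool" where
  "ownm_algorithm A \<longleftrightarrow> (\<forall>I. ownm_input I \<longrightarrow> (\<forall>ds\<in>set_pmf (run A I). feasible I ds))"

definition expected_profit :: "online_alg \<Rightarrow> input \<Rightarrow> real" where
  "expected_profit A I = measure_pmf.expectation (run A I) (profit I)"

definition strictly_competitive :: "real \<Rightarrow> online_alg \<Rightarrow> bool" where
  "strictly_competitive c A \<longleftrightarrow> ownm_algorithm A \<and>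
     (\<forall>I. ownm_input I \<longrightarrow> expected_profit A I \<ge> c * opt I)"

definition orientation :: "point \<Rightarrow> point \<Rightarrow> point \<Rightarrow> real" where
  "orientation a b x = (b $ 1 - a $ 1) * (x $ 2 - a $ 2) - (b $ 2 - a $ 2) * (x $ 1 - a $ 1)"

lemma orientation_eq_0_iff:
  assumes "a \<noteq> b"
  shows "orientation a b x = 0 \<longleftrightarrow> x \<in> affine hull {a, b}"
proof
  assume o: "orientation a b x = 0"
  have "a $ 1 \<noteq> b $ 1 \<or> a $ 2 \<noteq> b $ 2"
    using assms by (auto simp: vec_eq_iff forall_2)
  then obtain t where "x = a + t *\<^sub>R (b - a)"
  proof
    assume ne: "a $ 1 \<noteq> b $ 1"
    define t where "t = (x $ 1 - a $ 1) / (b $ 1 - a $ 1)"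
    have t: "t * (b $ 1 - a $ 1) = x $ 1 - a $ 1" using ne by (simp add: t_def)
    have "(b $ 1 - a $ 1) * (t * (b $ 2 - a $ 2)) = (b $ 1 - a $ 1) * (x $ 2 - a $ 2)"
      using o t unfolding orientation_def by algebra
    then have "t * (b $ 2 - a $ 2) = x $ 2 - a $ 2" using ne by simp
    with t have "x = a + t *\<^sub>R (b - a)" by (simp add: vec_eq_iff forall_2)
    then show thesis by (rule that)
  next
    assume ne: "a $ 2 \<noteq> b $ 2"
    define t where "t = (x $ 2 - a $ 2) / (b $ 2 - a $ 2)"
    have t: "t * (b $ 2 - a $ 2) = x $ 2 - a $ 2" using ne by (simp add: t_def)
    have "(b $ 2 - a $ 2) * (t * (b $ 1 - a $ 1)) = (b $ 2 - a $ 2) * (x $ 1 - a $ 1)"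
      using o t unfolding orientation_def by algebra
    then have "t * (b $ 1 - a $ 1) = x $ 1 - a $ 1" using ne by simp
    with t have "x = a + t *\<^sub>R (b - a)" by (simp add: vec_eq_iff forall_2)
    then show thesis by (rule that)
  qed
  then have "x = (1 - t) *\<^sub>R a + t *\<^sub>R b" by (simp add: algebra_simps)
  then show "x \<in> affine hull {a, b}"
    unfolding affine_hull_2 by (force intro: exI[of _ "1 - t"])
next
  assume "x \<in> affine hull {a, b}"
  then obtain u v where x: "x = u *\<^sub>R a + v *\<^sub>R b" "u + v = 1"
    unfolding affine_hull_2 by auto
  then have u: "u = 1 - v" by simp
  show "orientation a b x = 0"
    unfolding x(1) u orientation_def by (simp add: algebra_simps)
qed

text \<open>
  \<open>regions p m\<close> is the partition after the arrival of the points \<open>p 0, \<dots>, p (m - 1)\<close>, each region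
  being paired with the index of its responsible point.  When only the root has arrived it is
  taken to be responsible for the whole plane; the rule for splitting a region then also covers the
  second point.  Regions are open: the dividing lines belong to no region, and no later point of
  an input in general position lies on them.
\<close>

fun regions :: "(nat \<Rightarrow> point) \<Rightarrow> nat \<Rightarrow> (point set \<times> nat) set" where
  "regions p 0 = {}"
| "regions p (Suc 0) = {(UNIV, 0)}"
| "regions p (Suc (Suc m)) = (let i = Suc m in
     \<Union>(R, j)\<in>regions p i.
       if p i \<in> R
       then {({x \<in> R. orientation (p j) (p i) x > 0}, i), ({x \<in> R. orientation (p j) (p i) x < 0}, i)}
       else {(R, j)})"

definition parent :: "(nat \<Rightarrow> point) \<Rightarrow> nat \<Rightarrow> nat" where
  "parent p i = (THE j. \<exists>R. (R, j) \<in> regions p i \<and> p i \<in> R)"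

definition earlier_children :: "(nat \<Rightarrow> point) \<Rightarrow> nat \<Rightarrow> nat \<Rightarrow> nat set" where
  "earlier_children p i j = {k. 0 < k \<and> k < i \<and> parent p k = j}"

definition match_with_prob :: "real \<Rightarrow> nat \<Rightarrow> nat option pmf" where
  "match_with_prob q j = map_pmf (\<lambda>b. if b then Some j else None) (bernoulli_pmf q)"

definition tgm :: online_alg where
  "tgm xs ds = (let i = length xs - 1; p = (\<lambda>k. fst (xs ! k)); j = parent p i in
     if i = 0 then return_pmf None
     else if i = 1 then match_with_prob (1/3) 0
     else if \<not> matched ds j \<and> card (earlier_children p i j) = 0 then match_with_prob (1/2) j
     else if \<not> matched ds j \<and> card (earlier_children p i j) = 1 then match_with_prob 1 j
     else return_pmf None)"

end

theory Submission
  imports Defs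
begin

text \<open>
  Every point other than the root is matched on arrival with probability exactly \<open>1/3\<close>: if the
  parent \<open>j\<close> was matched on its own arrival with probability \<open>1/3\<close>, then it is free with probability
  \<open>2/3\<close> when its first child arrives, which therefore takes it with probability \<open>1/3\<close>; it is free
  with probability \<open>2/3 - 1/3 = 1/3\<close> when its second child arrives, which takes it for sure.  There
  is no third child, as \<open>j\<close> is responsible for two regions initially and loses one with every
  child.  The root is matched exactly when its only child is matched on arrival.

  The segments do not cross because no region meets an earlier edge of the tree, while a region is
  convex and contains the whole segment from any of its points to the responsible point, except for
  the latter.
\<close>

section \<open>The regions\<close>

lemma nat_induct_pos [consumes 1, case_names one Suc]:
  assumes "0 < m"
    and "P (Suc 0)"
    and "\<And>m. 0 < m \<Longrightarrow> P m \<Longrightarrow> P (Suc m)"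
  shows "P (m :: nat)"
  using assms by (metis nat_induct_non_zero One_nat_def)

text \<open>Turns the recursion at \<open>Suc (Suc m)\<close> into one step from any positive stage,
  which fits inductions that start with the whole plane at stage 1.\<close>

lemma regions_Suc_iff:
  assumes "0 < m"
  shows "(S, k) \<in> regions p (Suc m) \<longleftrightarrow> (\<exists>R j. (R, j) \<in> regions p m \<and>
     (if p m \<in> R
      then k = m \<and> (S = {x \<in> R. orientation (p j) (p m) x > 0} \<or>
                     S = {x \<in> R. orientation (p j) (p m) x < 0})
      else S = R \<and> k = j))"
proof -
  obtain m' where m: "m = Suc m'" using assms by (cases m) auto
  have union: "(S, k) \<in> (\<Union>(R, j)\<in>A. f R j) \<longleftrightarrow> (\<exists>R j. (R, j) \<in> A \<and> (S, k) \<in> f R j)"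
    for A :: "(point set \<times> nat) set" and f
    by auto
  show ?thesis unfolding m regions.simps Let_def union
    by (intro ex_cong1 conj_cong refl) auto
qed

lemma regions_Suc_cases:
  assumes "0 < m" "(S, k) \<in> regions p (Suc m)"
  obtains (old) "(S, k) \<in> regions p m" "p m \<notin> S"
  | (left) R j where "(R, j) \<in> regions p m" "p m \<in> R" "k = m"
      "S = {x \<in> R. orientation (p j) (p m) x > 0}"
  | (right) R j where "(R, j) \<in> regions p m" "p m \<in> R" "k = m"
      "S = {x \<in> R. orientation (p j) (p m) x < 0}"
  using assms(2) unfolding regions_Suc_iff[OF assms(1)] by (metis (no_types, lifting))

lemma regions_responsible_less: "(R, j) \<in> regions p m \<Longrightarrow> j < m"
proof (induction m arbitrary: R j)
  case (Suc m)
  show ?case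
  proof (cases "m = 0")
    case True
    then show ?thesis using Suc.prems by simp
  next
    case False
    then have "0 < m" by simp
    then show ?thesis using Suc.prems
      by (cases rule: regions_Suc_cases) (auto dest: Suc.IH simp: less_Suc_eq)
  qed
qed simp

lemma finite_regions: "finite (regions p m)"
  by (induction p m rule: regions.induct) (auto simp: Let_def)

lemma finite_regions_of: "finite {R. (R, j) \<in> regions p m}"
  by (rule finite_subset[OF _ finite_imageI[of _ fst, OF finite_regions[of p m]]])
    (auto intro: rev_image_eqI)

text \<open>The algorithm sees only a prefix of the input, so its tree is computed from a truncated
  sequence. Responsible indices are smaller than the stage, so points that have not arrived do not
  enter the partition.\<close>

lemma regions_cong:
  assumes "\<And>k. k < m \<Longrightarrow> p k = q k"
  shows "regions p m = regions q m"
proof (cases "m = 0")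
  case False
  then have "0 < m" by simp
  then show ?thesis using assms
  proof (induction m rule: nat_induct_pos)
    case (Suc m)
    then have IH: "regions p m = regions q m" by simp
    have pq: "p m = q m" "\<And>R j. (R, j) \<in> regions q m \<Longrightarrow> p j = q j"
      using Suc.prems regions_responsible_less by (auto simp: less_Suc_eq)
    have "(S, k) \<in> regions p (Suc m) \<longleftrightarrow> (S, k) \<in> regions q (Suc m)" for S k
      unfolding regions_Suc_iff[OF Suc.hyps] IH
      by (intro ex_cong1 conj_cong refl) (auto simp: pq)
    then show ?case by auto
  qed simp
qed simp

lemma parent_cong:
  assumes "\<And>k. k \<le> i \<Longrightarrow> p k = q k"
  shows "parent p i = parent q i"
  unfolding parent_def using assms regions_cong[of i p q] by simp

lemma earlier_children_cong:
  assumes "\<And>k. k < i \<Longrightarrow> p k = q k"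
  shows "earlier_children p i j = earlier_children q i j"
proof -
  have "parent p k = parent q k" if "k < i" for k
    using assms that by (intro parent_cong) auto
  then show ?thesis unfolding earlier_children_def by auto
qed

section \<open>Convexity of the regions and their position relative to the arrived points\<close>

lemma orientation_affine:
  assumes "u + v = 1"
  shows "orientation a b (u *\<^sub>R x + v *\<^sub>R y) = u * orientation a b x + v * orientation a b y"
proof -
  have v: "v = 1 - u" using assms by simp
  show ?thesis unfolding v orientation_def by (simp add: algebra_simps)
qed

lemma orientation_self [simp]: "orientation a b a = 0" "orientation a b b = 0"
  by (simp_all add: orientation_def algebra_simps)

lemma orientation_closed_segment:
  "x \<in> closed_segment a b \<Longrightarrow> orientation a b x = 0"
  unfolding in_segment by (auto simp: orientation_affine)

lemma convex_orientation:
  "convex {x. orientation a b x > 0}" "convex {x. orientation a b x < 0}"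
proof -
  show "convex {x. orientation a b x > 0}"
    unfolding convex_alt
  proof (intro ballI allI impI)
    fix x y and u :: real
    assume "x \<in> {x. orientation a b x > 0}" "y \<in> {x. orientation a b x > 0}" "0 \<le> u \<and> u \<le> 1"
    then have "(1 - u) * - orientation a b x + u * - orientation a b y < 0"
      by (intro convex_bound_lt) auto
    then show "(1 - u) *\<^sub>R x + u *\<^sub>R y \<in> {x. orientation a b x > 0}"
      by (simp add: orientation_affine)
  qed
  show "convex {x. orientation a b x < 0}"
    unfolding convex_alt
  proof (intro ballI allI impI)
    fix x y and u :: real
    assume "x \<in> {x. orientation a b x < 0}" "y \<in> {x. orientation a b x < 0}" "0 \<le> u \<and> u \<le> 1"
    then have "(1 - u) * orientation a b x + u * orientation a b y < 0"
      by (intro convex_bound_lt) auto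
    then show "(1 - u) *\<^sub>R x + u *\<^sub>R y \<in> {x. orientation a b x < 0}"
      by (simp add: orientation_affine)
  qed
qed

lemma regions_convex: "(R, j) \<in> regions p m \<Longrightarrow> convex R"
proof (induction m arbitrary: R j)
  case (Suc m)
  show ?case
  proof (cases "m = 0")
    case True
    then show ?thesis using Suc.prems by simp
  next
    case False
    then have "0 < m" by simp
    then show ?thesis using Suc.prems
    proof (cases rule: regions_Suc_cases)
      case old
      then show ?thesis using Suc.IH by blast
    next
      case (left R' j')
      then show ?thesis
        using convex_Int[OF Suc.IH[OF left(1)] convex_orientation(1)] by (simp add: Int_def)
    next
      case (right R' j')
      then show ?thesis
        using convex_Int[OF Suc.IH[OF right(1)] convex_orientation(2)] by (simp add: Int_def)
    qed
  qed
qed simp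

text \<open>A surviving region keeps its responsible point, so only the halves created by
  \<open>p m\<close> need an argument: the segment from \<open>p m\<close> stays in the convex
  region being split and on one side of the dividing line.\<close>

lemma regions_open_segment:
  "(R, j) \<in> regions p m \<Longrightarrow> x \<in> R \<Longrightarrow> open_segment (p j) x \<subseteq> R"
proof (induction m arbitrary: R j)
  case (Suc m)
  show ?case
  proof (cases "m = 0")
    case True
    then show ?thesis using Suc.prems by simp
  next
    case False
    then have m: "0 < m" by simp
    have inR: "open_segment (p m) x \<subseteq> R'"
      if "(R', j') \<in> regions p m" "p m \<in> R'" "x \<in> R'" for R' j'
      using regions_convex[OF that(1)] that(2,3)
      by (meson convex_contains_open_segment)
    \<comment> \<open>The orientation is affine in its last argument and vanishes at
      \<open>p m\<close>; along the segment it is a positive multiple of its value at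
      \<open>x\<close> and keeps its sign.\<close>
    have ori: "\<exists>u>0. orientation (p j') (p m) y = u * orientation (p j') (p m) x"
      if y: "y \<in> open_segment (p m) x" for j' y
      using y unfolding in_segment by (auto simp: orientation_affine)
    from m Suc.prems(1) show ?thesis
    proof (cases rule: regions_Suc_cases)
      case old
      then show ?thesis using Suc by blast
    next
      case (left R' j')
      show ?thesis
      proof
        fix y assume "y \<in> open_segment (p j) x"
        with left Suc.prems(2) inR[of R' j'] ori[of y j']
        show "y \<in> R" by (auto simp: subset_iff)
      qed
    next
      case (right R' j')
      show ?thesis
      proof
        fix y assume "y \<in> open_segment (p j) x"
        with right Suc.prems(2) inR[of R' j'] ori[of y j']
        show "y \<in> R" by (auto simp: subset_iff mult_pos_neg)
      qed
    qed
  qed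
qed simp

text \<open>Two regions through \<open>x\<close> come from regions of the previous stage through
  \<open>x\<close>, which coincide by induction; the sign of the orientation at \<open>x\<close>
  then selects the same half. Uniqueness of \<open>j\<close> makes the \<open>THE\<close> in
  \<open>parent\<close> meaningful.\<close>

lemma regions_disjoint:
  "(R, j) \<in> regions p m \<Longrightarrow> (R', j') \<in> regions p m \<Longrightarrow> x \<in> R \<Longrightarrow> x \<in> R' \<Longrightarrow> R = R' \<and> j = j'"
proof (induction m arbitrary: R j R' j')
  case (Suc m)
  show ?case
  proof (cases "m = 0")
    case True
    then show ?thesis using Suc.prems by simp
  next
    case False
    then have m: "0 < m" by simp
    obtain Q i where Q: "(Q, i) \<in> regions p m" "x \<in> Q"
      "if p m \<in> Q
      then j = m \<and> (R = {x \<in> Q. orientation (p i) (p m) x > 0} \<or>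
                     R = {x \<in> Q. orientation (p i) (p m) x < 0})
      else R = Q \<and> j = i"
      using Suc.prems(1,3) unfolding regions_Suc_iff[OF m] by (auto split: if_splits)
    obtain Q' i' where Q': "(Q', i') \<in> regions p m" "x \<in> Q'"
      "if p m \<in> Q'
      then j' = m \<and> (R' = {x \<in> Q'. orientation (p i') (p m) x > 0} \<or>
                     R' = {x \<in> Q'. orientation (p i') (p m) x < 0})
      else R' = Q' \<and> j' = i'"
      using Suc.prems(2,4) unfolding regions_Suc_iff[OF m] by (auto split: if_splits)
    have "Q = Q' \<and> i = i'" using Suc.IH Q Q' by blast
    then show ?thesis using Q(3) Q'(3) Suc.prems(3,4) by (auto split: if_splits)
  qed
qed simp

text \<open>The new point lies on the line that splits its region, and every region is contained in
  one of the previous stage. The hypothesis \<open>0 < m\<close> leaves out the whole plane, which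
  contains the root; at the first split both points lie on the line.\<close>

lemma points_notin_regions:
  "0 < m \<Longrightarrow> (R, j) \<in> regions p (Suc m) \<Longrightarrow> k \<le> m \<Longrightarrow> p k \<notin> R"
proof (induction m arbitrary: R j)
  case (Suc m)
  have m: "0 < Suc m" by simp
  have IH: "p k \<notin> R'" if "(R', j') \<in> regions p (Suc m)" "k \<le> m" "0 < m" for R' j'
    using Suc.IH that by blast
  from m Suc.prems(2) show ?case
  proof (cases rule: regions_Suc_cases)
    case old
    then show ?thesis using IH Suc.prems(3) by (cases "m = 0") (auto simp: le_Suc_eq)
  next
    case (left R' j')
    then show ?thesis using IH Suc.prems(3) by (cases "m = 0") (auto simp: le_Suc_eq)
  next
    case (right R' j')
    then show ?thesis using IH Suc.prems(3) by (cases "m = 0") (auto simp: le_Suc_eq)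
  qed
qed simp

lemma parent_eqI: "(R, j) \<in> regions p m \<Longrightarrow> p m \<in> R \<Longrightarrow> parent p m = j"
  unfolding parent_def by (rule the_equality) (auto dest: regions_disjoint)

lemma parent_1 [simp]: "parent p (Suc 0) = 0"
  by (rule parent_eqI[of UNIV]) auto

text \<open>The root is responsible only for the whole plane, which the second point splits. Hence
  no point of index at least 2 is a child of the root.\<close>

lemma regions_responsible_pos:
  "0 < m \<Longrightarrow> (R, j) \<in> regions p (Suc m) \<Longrightarrow> 0 < j"
proof (induction m arbitrary: R j)
  case (Suc m)
  have m: "0 < Suc m" by simp
  from m Suc.prems(2) show ?case
    by (cases rule: regions_Suc_cases) (use Suc.IH in \<open>cases "m = 0"; auto\<close>)+
qed simp

text \<open>A point on no line through two arrived points never falls on a dividing line, so each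
  split of its region leaves it in one of the halves.\<close>

lemma regions_cover:
  assumes "0 < m" "\<And>k l. k < m \<Longrightarrow> l < m \<Longrightarrow> k \<noteq> l \<Longrightarrow> orientation (p k) (p l) x \<noteq> 0"
  shows "\<exists>R j. (R, j) \<in> regions p m \<and> x \<in> R"
  using assms
proof (induction m rule: nat_induct_pos)
  case (Suc m)
  then obtain R j where R: "(R, j) \<in> regions p m" "x \<in> R" by fastforce
  have "j < m" using R(1) by (rule regions_responsible_less)
  then have "orientation (p j) (p m) x \<noteq> 0" using Suc.prems by auto
  then have sides: "x \<in> {x \<in> R. orientation (p j) (p m) x > 0} \<or>
      x \<in> {x \<in> R. orientation (p j) (p m) x < 0}"
    using R(2) by auto
  show ?case
  proof (cases "p m \<in> R")
    case True
    have "({x \<in> R. orientation (p j) (p m) x > 0}, m) \<in> regions p (Suc m)"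
      "({x \<in> R. orientation (p j) (p m) x < 0}, m) \<in> regions p (Suc m)"
      unfolding regions_Suc_iff[OF Suc.hyps]
      by (intro exI[of _ R] exI[of _ j] conjI R(1); simp add: True)+
    then show ?thesis using sides by blast
  next
    case False
    have "(R, j) \<in> regions p (Suc m)"
      unfolding regions_Suc_iff[OF Suc.hyps]
      by (intro exI[of _ R] exI[of _ j] conjI R(1)) (simp add: False)
    then show ?thesis using R(2) by blast
  qed
qed simp

lemma earlier_children_Suc:
  "earlier_children p (Suc m) j =
     (if 0 < m \<and> parent p m = j then insert m (earlier_children p m j) else earlier_children p m j)"
  by (auto simp: earlier_children_def less_Suc_eq)

lemma finite_earlier_children: "finite (earlier_children p m j)"
  by (simp add: earlier_children_def)

section \<open>The tree of points in general position\<close>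

text \<open>The geometry is developed for an index function instead of an input list;
  \<open>N\<close> bounds the indices at which general position is available.\<close>

locale generic_points =
  fixes p :: "nat \<Rightarrow> point" and N :: nat
  assumes orientation_nonzero:
    "k < N \<Longrightarrow> l < N \<Longrightarrow> m < N \<Longrightarrow> k \<noteq> l \<Longrightarrow> k \<noteq> m \<Longrightarrow> l \<noteq> m \<Longrightarrow>
       orientation (p k) (p l) (p m) \<noteq> 0"
begin

section \<open>Parents, edges and the number of children\<close>

lemma parent_region:
  assumes "0 < m" "m < N"
  obtains R where "(R, parent p m) \<in> regions p m" "p m \<in> R"
proof -
  obtain R j where "(R, j) \<in> regions p m" "p m \<in> R"
    using regions_cover[of m p "p m"] orientation_nonzero assms by force
  then show thesis using that parent_eqI by blast
qed

lemma parent_less: "0 < m \<Longrightarrow> m < N \<Longrightarrow> parent p m < m"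
  by (meson parent_region regions_responsible_less)

lemma parent_pos: "2 \<le> m \<Longrightarrow> m < N \<Longrightarrow> 0 < parent p m"
  using parent_region[of m] regions_responsible_pos[of "m - 1"]
  by (metis One_nat_def Suc_1 Suc_diff_1 Suc_le_lessD less_trans zero_less_Suc zero_less_diff)

lemma segment_subset_region:
  assumes "(R, j) \<in> regions p m" "p m \<in> R"
  shows "closed_segment (p m) (p j) \<subseteq> insert (p j) R"
  using regions_open_segment[OF assms] assms(2)
  by (auto simp: closed_segment_eq_open open_segment_commute)

text \<open>An older edge is avoided because every region lies in one of the previous stage. The
  newest edge lies in the split region \<open>R\<close> together with the parent's point: the
  surviving regions are disjoint from \<open>R\<close> and contain no arrived point, and the halves
  of \<open>R\<close> omit the dividing line that carries the edge.\<close>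

lemma regions_avoid_edges:
  assumes "0 < m" "m \<le> N" "(S, l) \<in> regions p m" "0 < k" "k < m"
  shows "S \<inter> closed_segment (p k) (p (parent p k)) = {}"
  using assms
proof (induction m arbitrary: S l rule: nat_induct_pos)
  case (Suc m)
  show ?case
  proof (cases "k = m")
    case False
    have "\<exists>R j. (R, j) \<in> regions p m \<and> S \<subseteq> R"
      using Suc.hyps Suc.prems(2) by (cases rule: regions_Suc_cases) auto
    then show ?thesis using Suc.IH Suc.prems False by fastforce
  next
    case k: True
    obtain R where R: "(R, parent p m) \<in> regions p m" "p m \<in> R"
      by (rule parent_region[of m]) (use Suc in auto)
    note seg = segment_subset_region[OF R]
    have line: "orientation (p (parent p m)) (p m) x = 0"
      if "x \<in> closed_segment (p m) (p (parent p m))" for x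
      using that orientation_closed_segment by (simp add: closed_segment_commute)
    from Suc.hyps Suc.prems(2) show ?thesis
    proof (cases rule: regions_Suc_cases)
      case old
      then have "S \<inter> R = {}" using regions_disjoint[OF _ R(1)] R(2) by blast
      moreover have "p (parent p m) \<notin> S"
        using points_notin_regions[OF Suc.hyps Suc.prems(2)] regions_responsible_less[OF R(1)]
        by simp
      ultimately show ?thesis using seg k by blast
    next
      case (left R' j')
      then show ?thesis using line parent_eqI[OF left(1,2)] k by fastforce
    next
      case (right R' j')
      then show ?thesis using line parent_eqI[OF right(1,2)] k by fastforce
    qed
  qed
qed simp

text \<open>The sum acts as a potential: a new point starts with at most two regions and no
  children, and each child takes one region from its parent. It is an inequality since the root
  starts with one region.\<close>

lemma card_regions_children_le:
  assumes "0 < m" "m \<le> N"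
  shows "card {R. (R, j) \<in> regions p m} + card (earlier_children p m j) \<le> 2"
  using assms
proof (induction m arbitrary: j rule: nat_induct_pos)
  case one
  have "{R. (R, j) \<in> regions p (Suc 0)} \<subseteq> {UNIV}" by auto
  from card_mono[OF _ this] have "card {R. (R, j) \<in> regions p (Suc 0)} \<le> 1" by simp
  moreover have "earlier_children p (Suc 0) j = {}" by (auto simp: earlier_children_def)
  ultimately show ?case by simp
next
  case (Suc m)
  obtain R where R: "(R, parent p m) \<in> regions p m" "p m \<in> R"
    by (rule parent_region[of m]) (use Suc in auto)
  show ?case
  proof (cases "j = m")
    case True
    have "parent p k \<noteq> m" if "0 < k" "k < Suc m" for k
      using parent_less[of k] that Suc.prems by linarith
    then have "earlier_children p (Suc m) m = {}"
      by (auto simp: earlier_children_def)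
    moreover have "{S. (S, m) \<in> regions p (Suc m)} \<subseteq>
        {{x \<in> R. orientation (p (parent p m)) (p m) x > 0},
         {x \<in> R. orientation (p (parent p m)) (p m) x < 0}}"
    proof
      fix S assume "S \<in> {S. (S, m) \<in> regions p (Suc m)}"
      then have "(S, m) \<in> regions p (Suc m)" by simp
      with Suc.hyps show "S \<in> {{x \<in> R. orientation (p (parent p m)) (p m) x > 0},
         {x \<in> R. orientation (p (parent p m)) (p m) x < 0}}"
      proof (cases rule: regions_Suc_cases)
        case old
        then show ?thesis using regions_responsible_less[of S m p m] by simp
      next
        case (left R' j')
        then show ?thesis using regions_disjoint[OF R(1) left(1) R(2) left(2)] by simp
      next
        case (right R' j')
        then show ?thesis using regions_disjoint[OF R(1) right(1) R(2) right(2)] by simp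
      qed
    qed
    from card_mono[OF _ this] have "card {S. (S, m) \<in> regions p (Suc m)} \<le> 2"
      by (simp add: card_insert_if split: if_splits)
    ultimately show ?thesis using True by simp
  next
    case False
    \<comment> \<open>Only a region that avoids the new point keeps a responsible point other than
      \<open>m\<close>.\<close>
    then have sub: "{S. (S, j) \<in> regions p (Suc m)} \<subseteq> {S. (S, j) \<in> regions p m} - {S. p m \<in> S}"
      by (auto elim!: regions_Suc_cases[OF Suc.hyps])
    have IH: "card {R. (R, j) \<in> regions p m} + card (earlier_children p m j) \<le> 2"
      using Suc by simp
    show ?thesis
    proof (cases "parent p m = j")
      case True
      have "card {S. (S, j) \<in> regions p (Suc m)} \<le> card ({S. (S, j) \<in> regions p m} - {R})"
        using sub R(2) finite_regions_of by (intro card_mono) auto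
      also have "\<dots> < card {S. (S, j) \<in> regions p m}"
        using R(1) True finite_regions_of by (intro psubset_card_mono) auto
      finally show ?thesis
        using IH True Suc.hyps finite_earlier_children[of p m j]
        by (simp add: earlier_children_Suc card_insert_if)
    next
      case False
      have "card {S. (S, j) \<in> regions p (Suc m)} \<le> card {S. (S, j) \<in> regions p m}"
        using sub finite_regions_of by (intro card_mono) auto
      then show ?thesis using IH False by (simp add: earlier_children_Suc)
    qed
  qed
qed

text \<open>The region in which \<open>m\<close> arrives still belongs to its parent and contributes
  at least 1 to the bound 2, so \<open>m\<close> is a first or second child.\<close>

lemma card_earlier_children_parent_le:
  assumes "0 < m" "m < N"
  shows "card (earlier_children p m (parent p m)) \<le> 1"
proof -
  obtain R where R: "(R, parent p m) \<in> regions p m"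
    using parent_region assms by blast
  then have "card {R. (R, parent p m) \<in> regions p m} > 0"
    using finite_regions_of by (auto simp: card_gt_0_iff)
  then show ?thesis using card_regions_children_le[of m "parent p m"] assms by simp
qed

text \<open>The hypotheses say that the two edges share no endpoint, as
  \<open>parent p k < k < m\<close>. The later edge without its parent endpoint lies in a region,
  and regions avoid earlier edges; that endpoint is off the earlier edge by general
  position.\<close>

lemma edges_disjoint:
  assumes "0 < k" "k < m" "m < N" "parent p m \<noteq> k" "parent p m \<noteq> parent p k"
  shows "closed_segment (p k) (p (parent p k)) \<inter> closed_segment (p m) (p (parent p m)) = {}"
proof -
  obtain R where R: "(R, parent p m) \<in> regions p m" "p m \<in> R"
    by (rule parent_region[of m]) (use assms in auto)
  have "R \<inter> closed_segment (p k) (p (parent p k)) = {}"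
    using regions_avoid_edges[OF _ _ R(1)] assms by simp
  moreover have "p (parent p m) \<notin> closed_segment (p k) (p (parent p k))"
    using orientation_closed_segment orientation_nonzero[of k "parent p k" "parent p m"]
      parent_less[of k] parent_less[of m] assms by fastforce
  ultimately show ?thesis using segment_subset_region[OF R] by blast
qed

end

section \<open>Runs of the algorithm\<close>

lemma prob_bind_pmf:
  "measure_pmf.prob (bind_pmf M f) S = (\<integral>x. measure_pmf.prob (f x) S \<partial>measure_pmf M)"
  using measurable_measure_pmf[of f] unfolding measure_pmf_bind
  by (intro measure_pmf.measure_bind[where N = "count_space UNIV"]) auto

text \<open>Decisions are irrevocable: later steps only append, so the law of the first
  \<open>k\<close> entries is settled at stage \<open>k\<close>.\<close>

lemma map_pmf_take_run_steps:
  assumes "k \<le> m"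
  shows "map_pmf (take k) (run_steps A I m) = run_steps A I k"
proof -
  have len: "length ds = m" if "ds \<in> set_pmf (run_steps A I m)" for ds m
    using that by (induction m arbitrary: ds) auto
  from assms show ?thesis
  proof (induction m rule: dec_induct)
    case base
    show ?case by (rule pmf.map_ident_strong) (auto dest: len)
  next
    case (step m)
    have "map_pmf (take k) (run_steps A I (Suc m)) =
        bind_pmf (run_steps A I m) (\<lambda>ds. return_pmf (take k ds))"
      using step.hyps len
      by (auto simp: map_bind_pmf map_pmf_comp intro!: bind_pmf_cong)
    then show ?case using step.IH by (simp add: map_pmf_def)
  qed
qed

lemma prob_run_steps_prefix:
  assumes "k \<le> m" "\<And>ds. ds \<in> set_pmf (run_steps A I m) \<Longrightarrow> ds \<in> S \<longleftrightarrow> take k ds \<in> T"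
  shows "measure_pmf.prob (run_steps A I m) S = measure_pmf.prob (run_steps A I k) T"
proof -
  have "measure_pmf.prob (run_steps A I m) S = measure_pmf.prob (run_steps A I m) (take k -` T)"
    by (rule measure_pmf.finite_measure_eq_AE) (auto intro!: AE_pmfI simp: assms(2))
  then show ?thesis
    by (simp flip: map_pmf_take_run_steps[OF assms(1)])
qed

lemma set_pmf_match_with_prob: "set_pmf (match_with_prob q j) \<subseteq> {None, Some j}"
  by (auto simp: match_with_prob_def)

lemma prob_match_with_prob:
  assumes "0 \<le> q" "q \<le> 1"
  shows "measure_pmf.prob (match_with_prob q j) {d. d \<noteq> None} = q"
proof -
  have "measure_pmf.prob (match_with_prob q j) {d. d \<noteq> None} =
      measure_pmf.prob (bernoulli_pmf q) {True}"
    unfolding match_with_prob_def measure_map_pmf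
    by (rule arg_cong[of _ _ "measure_pmf.prob _"]) auto
  also have "\<dots> = q" using assms by (simp add: measure_pmf_single)
  finally show ?thesis .
qed

section \<open>The algorithm on a fixed input: possible outcomes and feasibility\<close>

locale tgm_run =
  fixes I :: input
  assumes valid: "ownm_input I"
begin

definition p :: "nat \<Rightarrow> point" where
  "p k = fst (I ! k)"

sublocale generic_points p "length I"
proof
  fix k l m assume less: "k < length I" "l < length I" "m < length I"
    and ne: "k \<noteq> l" "k \<noteq> m" "l \<noteq> m"
  have gp: "general_position (map fst I)" using valid by (simp add: ownm_input_def)
  then have "distinct (map fst I)" by (simp add: general_position_def)
  then have dist: "p k \<noteq> p l" "p k \<noteq> p m" "p l \<noteq> p m"
    using less ne nth_eq_iff_index_eq[of "map fst I"] by (auto simp: p_def)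
  moreover have "p k \<in> set (map fst I)" "p l \<in> set (map fst I)" "p m \<in> set (map fst I)"
    using less by (auto simp: p_def)
  ultimately have "\<not> collinear {p k, p l, p m}"
    using gp unfolding general_position_def by blast
  then show "orientation (p k) (p l) (p m) \<noteq> 0"
    unfolding orientation_eq_0_iff[OF dist(1)] using dist
    by (simp add: collinear_3_affine_hull)
qed

abbreviation "par \<equiv> parent p"

abbreviation "prefix_run m \<equiv> run_steps tgm I m"

lemma length_ge_2: "2 \<le> length I"
  using valid by (auto simp: ownm_input_def)

lemma tgm_take:
  assumes "i < length I"
  shows "tgm (take (Suc i) I) ds =
     (if i = 0 then return_pmf None
      else if i = 1 then match_with_prob (1/3) 0
      else if \<not> matched ds (par i) \<and> card (earlier_children p i (par i)) = 0
        then match_with_prob (1/2) (par i)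
      else if \<not> matched ds (par i) \<and> card (earlier_children p i (par i)) = 1
        then match_with_prob 1 (par i)
      else return_pmf None)"
proof -
  have eq: "fst (take (Suc i) I ! k) = p k" if "k \<le> i" for k
    using that by (simp add: p_def)
  have [simp]: "length (take (Suc i) I) - 1 = i" using assms by simp
  have [simp]: "parent (\<lambda>k. fst (take (Suc i) I ! k)) i = par i"
    by (rule parent_cong) (rule eq)
  have [simp]: "earlier_children (\<lambda>k. fst (take (Suc i) I ! k)) i j = earlier_children p i j" for j
    by (rule earlier_children_cong) (rule eq, simp)
  show ?thesis unfolding tgm_def Let_def by (simp only: refl \<open>length _ - 1 = i\<close>) simp
qed

text \<open>An invariant of the outcomes of positive probability: every match goes to the parent,
  which is free at that time. The conjunct \<open>0 < k\<close> makes the root's own entry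
  \<open>None\<close>.\<close>

definition consistent :: "outcome \<Rightarrow> bool" where
  "consistent ds \<longleftrightarrow> (\<forall>k<length ds. ds ! k = None \<or>
     (0 < k \<and> ds ! k = Some (par k) \<and> \<not> matched (take k ds) (par k)))"

lemma run_consistent:
  "m \<le> length I \<Longrightarrow> ds \<in> set_pmf (prefix_run m) \<Longrightarrow> length ds = m \<and> consistent ds"
proof (induction m arbitrary: ds)
  case (Suc m)
  from Suc.prems(2) obtain es d where ds: "ds = es @ [d]" "es \<in> set_pmf (prefix_run m)"
    and d: "d \<in> set_pmf (tgm (take (Suc m) I) es)" by auto
  have es: "length es = m" "consistent es" using Suc ds by auto
  have "d = None \<or> (0 < m \<and> d = Some (par m) \<and> \<not> matched es (par m))"
  \<comment> \<open>At the second arrival \<open>tgm\<close> does not test whether the root is free;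
    this follows from the root's entry being \<open>None\<close>.\<close>
  proof (cases "m = 1")
    case True
    have "es ! 0 = None" using es True by (auto simp: consistent_def)
    then have "es = [None]" using es(1) True by (cases es) auto
    then have "\<not> matched es 0" by (simp add: matched_def)
    then show ?thesis
      using d True Suc.prems(1) set_pmf_match_with_prob[of "1/3" 0] by (auto simp: tgm_take)
  next
    case False
    then show ?thesis
      using d Suc.prems(1) set_pmf_match_with_prob[of _ "par m"]
      by (auto simp: tgm_take split: if_splits)
  qed
  then show ?case using es unfolding ds(1)
    by (auto simp: consistent_def less_Suc_eq nth_append)
qed (simp add: consistent_def)

lemma feasible_run:
  assumes "ds \<in> set_pmf (run tgm I)"
  shows "feasible I ds"
proof -
  have ds: "length ds = length I" "consistent ds"
    using run_consistent[of "length I" ds] assms by (auto simp: run_def)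
  have dec: "0 < i \<and> j = par i \<and> \<not> matched (take i ds) j"
    if "i < length I" "ds ! i = Some j" for i j
    using ds that by (auto simp: consistent_def)
  have disj: "closed_segment (p i) (p j) \<inter> closed_segment (p i') (p j') = {}"
    if less: "i < i'" and i': "i' < length I" and dsi: "ds ! i = Some j" "ds ! i' = Some j'"
    for i i' j j'
  proof -
    have i: "i < length I" using less i' by simp
    have nth: "take i' ds ! i = Some j" "i < length (take i' ds)"
      using less i' ds dsi by auto
    \<comment> \<open>The earlier pair counts as matched in the prefix before \<open>i'\<close>,
      while \<open>j'\<close> must be free there; so the pairs share no endpoint.\<close>
    then have "matched (take i' ds) i" "matched (take i' ds) j"
      unfolding matched_def by (auto simp: in_set_conv_nth)
    then have "j' \<noteq> i" "j' \<noteq> j" using dec[OF i' dsi(2)] by auto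
    then show ?thesis
      using edges_disjoint[of i i'] less i' dec[OF i dsi(1)] dec[OF i' dsi(2)] by simp
  qed
  have "closed_segment (p i) (p j) \<inter> closed_segment (p i') (p j') = {}"
    if "i < length I" "i' < length I" "i \<noteq> i'" "ds ! i = Some j" "ds ! i' = Some j'" for i i' j j'
    using disj[of i i' j j'] disj[of i' i j' j] that by (metis Int_commute linorder_neqE_nat)
  then show ?thesis
    using ds(1) dec parent_less unfolding feasible_def p_def by metis
qed

section \<open>Matching probabilities and expected profit\<close>

lemma prob_arrival_step:
  assumes "i < length I"
    and "\<And>ds. ds \<in> set_pmf (prefix_run i) \<Longrightarrow>
      measure_pmf.prob (tgm (take (Suc i) I) ds) {d. d \<noteq> None} = q * indicator S ds"
  shows "measure_pmf.prob (prefix_run (Suc i)) {ds. ds ! i \<noteq> None} =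
     q * measure_pmf.prob (prefix_run i) S"
proof -
  have "measure_pmf.prob (prefix_run (Suc i)) {ds. ds ! i \<noteq> None} =
      (\<integral>ds. measure_pmf.prob (map_pmf (\<lambda>d. ds @ [d]) (tgm (take (Suc i) I) ds)) {ds. ds ! i \<noteq> None}
        \<partial>prefix_run i)"
    by (simp only: run_steps.simps prob_bind_pmf)
  \<comment> \<open>Conditioned on the earlier decisions, point \<open>i\<close> is matched with
    probability \<open>q\<close> inside \<open>S\<close> and 0 outside.\<close>
  also have "\<dots> = (\<integral>ds. q * indicator S ds \<partial>prefix_run i)"
  proof (intro integral_cong_AE AE_pmfI)
    fix ds assume ds: "ds \<in> set_pmf (prefix_run i)"
    then have "length ds = i" using run_consistent[of i] assms(1) by simp
    then have "(\<lambda>d. ds @ [d]) -` {ds. ds ! i \<noteq> None} = {d. d \<noteq> None}" by (auto simp: nth_append)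
    then show "measure_pmf.prob (map_pmf (\<lambda>d. ds @ [d]) (tgm (take (Suc i) I) ds))
        {ds. ds ! i \<noteq> None} = q * indicator S ds"
      using assms(2)[OF ds] by simp
  qed auto
  also have "\<dots> = q * measure_pmf.prob (prefix_run i) S"
    by simp
  finally show ?thesis .
qed

text \<open>In a consistent outcome only children of \<open>j\<close> choose \<open>j\<close> on
  arrival, so \<open>j\<close> is taken either on its own arrival or by a child that has
  arrived.\<close>

lemma matched_parent_iff:
  assumes "j < length ds" "consistent ds"
  shows "matched ds j \<longleftrightarrow>
    ds ! j \<noteq> None \<or> (\<exists>k\<in>earlier_children p (length ds) j. ds ! k \<noteq> None)"
proof -
  have "Some j \<in> set ds \<longleftrightarrow> (\<exists>k\<in>earlier_children p (length ds) j. ds ! k \<noteq> None)"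
    using assms(2) unfolding consistent_def earlier_children_def
    by (auto simp: in_set_conv_nth) (metis option.distinct(1) option.inject)+
  then show ?thesis using assms(1) by (auto simp: matched_def)
qed

text \<open>The stage \<open>m\<close> is arbitrary because the induction hypothesis is needed for
  the parent and the earlier sibling at stage \<open>i\<close>, just before \<open>i\<close> is
  decided.\<close>

lemma prob_arrival:
  "0 < i \<Longrightarrow> i < length I \<Longrightarrow> i < m \<Longrightarrow> m \<le> length I \<Longrightarrow>
     measure_pmf.prob (prefix_run m) {ds. ds ! i \<noteq> None} = 1/3"
proof (induction i arbitrary: m rule: less_induct)
  case (less i)
  have "measure_pmf.prob (prefix_run m) {ds. ds ! i \<noteq> None} =
      measure_pmf.prob (prefix_run (Suc i)) {ds. ds ! i \<noteq> None}"
    using less.prems by (intro prob_run_steps_prefix) auto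
  also have "\<dots> = 1/3"
  proof (cases "i = 1")
    case True
    have "measure_pmf.prob (prefix_run (Suc i)) {ds. ds ! i \<noteq> None} =
        1/3 * measure_pmf.prob (prefix_run i) UNIV"
      using less.prems True
      by (intro prob_arrival_step) (simp_all add: tgm_take prob_match_with_prob del: not_None_eq)
    then show ?thesis by simp
  next
    case False
    define j where "j = par i"
    \<comment> \<open>The parent is not the root, so the induction hypothesis covers its arrival;
      the root's own entry is always \<open>None\<close>.\<close>
    have j: "0 < j" "j < i"
      using parent_pos[of i] parent_less[of i] less.prems False by (auto simp: j_def)
    have IH: "measure_pmf.prob (prefix_run i) {ds. ds ! k \<noteq> None} = 1/3" if "0 < k" "k < i" for k
      using less.IH[of k i] less.prems that by simp
    have matched_iff: "matched ds j \<longleftrightarrow>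
        ds ! j \<noteq> None \<or> (\<exists>k\<in>earlier_children p i j. ds ! k \<noteq> None)"
      and cons: "length ds = i" "consistent ds" if "ds \<in> set_pmf (prefix_run i)" for ds
      using run_consistent[of i ds] matched_parent_iff[of j ds] that j less.prems by auto
    have free: "measure_pmf.prob (prefix_run i) {ds. \<not> matched ds j} =
        1 - measure_pmf.prob (prefix_run i) {ds. matched ds j}"
      using measure_pmf.prob_compl[of "{ds. matched ds j}" "prefix_run i"]
      by (simp add: Compl_eq_Diff_UNIV[symmetric] Collect_neg_eq)
    have "card (earlier_children p i j) \<le> 1"
      using card_earlier_children_parent_le[of i] less.prems by (simp add: j_def)
    then consider "card (earlier_children p i j) = 0" | "card (earlier_children p i j) = 1"
      by linarith
    then show ?thesis
    proof cases
      case 1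
      \<comment> \<open>Without an earlier child, \<open>j\<close> can have been matched only on its
        own arrival: it is free with probability \<open>2/3\<close>, and the coin of bias
        \<open>1/2\<close> gives \<open>1/3\<close>.\<close>
      then have "earlier_children p i j = {}" using finite_earlier_children by simp
      then have "measure_pmf.prob (prefix_run i) {ds. matched ds j} =
          measure_pmf.prob (prefix_run i) {ds. ds ! j \<noteq> None}"
        by (intro measure_pmf.finite_measure_eq_AE AE_pmfI) (auto simp: matched_iff)
      then have "measure_pmf.prob (prefix_run i) {ds. \<not> matched ds j} = 2/3"
        using IH[OF j] free by simp
      moreover have "measure_pmf.prob (prefix_run (Suc i)) {ds. ds ! i \<noteq> None} =
          1/2 * measure_pmf.prob (prefix_run i) {ds. \<not> matched ds j}"
        using less.prems False 1
        by (intro prob_arrival_step) (auto simp: tgm_take prob_match_with_prob j_def[symmetric]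
            simp del: not_None_eq)
      ultimately show ?thesis by simp
    next
      case 2
      then obtain k where k: "earlier_children p i j = {k}" by (auto simp: card_1_singleton_iff)
      then have "k \<in> earlier_children p i j" by simp
      then have k': "0 < k" "k < i" "par k = j" by (auto simp: earlier_children_def)
      then have "j < k" using parent_less[of k] less.prems by simp
      \<comment> \<open>The earlier child \<open>k\<close> takes \<open>j\<close> only if
        \<open>j\<close> was not matched on its own arrival, so the two ways of occupying
        \<open>j\<close> exclude each other and their probabilities add up to
        \<open>2/3\<close>.\<close>
      have excl: "ds ! j = None" if "ds \<in> set_pmf (prefix_run i)" "ds ! k \<noteq> None" for ds
      proof -
        have "\<not> matched (take k ds) j"
          using cons[OF that(1)] that(2) k' by (auto simp: consistent_def)
        then show ?thesis using cons[OF that(1)] \<open>j < k\<close> k' by (simp add: matched_def)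
      qed
      have "measure_pmf.prob (prefix_run i) {ds. matched ds j} =
          measure_pmf.prob (prefix_run i) ({ds. ds ! j \<noteq> None} \<union> {ds. ds ! k \<noteq> None})"
        by (intro measure_pmf.finite_measure_eq_AE AE_pmfI) (auto simp: matched_iff k)
      also have "\<dots> = measure_pmf.prob (prefix_run i) {ds. ds ! j \<noteq> None} +
          measure_pmf.prob (prefix_run i) {ds. ds ! k \<noteq> None}"
        by (intro measure_Un_AE AE_pmfI) (auto simp: excl fmeasurable_def less_top[symmetric])
      finally have "measure_pmf.prob (prefix_run i) {ds. \<not> matched ds j} = 1/3"
        using IH[OF j] IH[OF k'(1,2)] free by simp
      moreover have "measure_pmf.prob (prefix_run (Suc i)) {ds. ds ! i \<noteq> None} =
          1 * measure_pmf.prob (prefix_run i) {ds. \<not> matched ds j}"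
        using less.prems False 2
        by (intro prob_arrival_step) (auto simp: tgm_take prob_match_with_prob j_def[symmetric]
            simp del: not_None_eq)
      ultimately show ?thesis by simp
    qed
  qed
  finally show ?case .
qed

lemma prob_matched:
  assumes "i < length I"
  shows "measure_pmf.prob (run tgm I) {ds. matched ds i} \<ge> 1/3"
proof -
  \<comment> \<open>The arrival that yields the bound: for the root it is that of its only child,
    point 1, and for any other point its own. A point may also be taken later by a child, hence only
    an inequality.\<close>
  define k where "k = max 1 i"
  have k: "0 < k" "k < length I" using assms length_ge_2 by (auto simp: k_def)
  have "1/3 = measure_pmf.prob (run tgm I) {ds. ds ! k \<noteq> None}"
    using prob_arrival[OF k k(2)] by (simp add: run_def)
  also have "\<dots> \<le> measure_pmf.prob (run tgm I) {ds. matched ds i}"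
  proof (rule measure_pmf.finite_measure_mono_AE[OF AE_pmfI])
    fix ds assume "ds \<in> set_pmf (run tgm I)"
    then have ds: "length ds = length I" "consistent ds"
      using run_consistent[of "length I" ds] by (auto simp: run_def)
    have "matched ds i" if "ds ! k \<noteq> None"
    proof (cases "i = 0")
      case True
      then have "ds ! k = Some 0" using ds k that by (auto simp: consistent_def k_def)
      then show ?thesis using ds k True nth_mem[of k ds] by (simp add: matched_def)
    next
      case False
      then have "k = i" by (simp add: k_def)
      then show ?thesis using ds that assms by (simp add: matched_def)
    qed
    then show "ds \<in> {ds. ds ! k \<noteq> None} \<longrightarrow> ds \<in> {ds. matched ds i}" by simp
  qed simp
  finally show ?thesis .
qed

lemma expected_profit_ge: "expected_profit tgm I \<ge> 1/3 * opt I"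
proof -
  \<comment> \<open>Moving the condition \<open>matched ds i\<close> into an indicator makes the
    index range independent of the outcome, so that linearity of expectation applies.\<close>
  have profit: "profit I ds = (\<Sum>i<length I. snd (I ! i) * indicator {ds. matched ds i} ds)" for ds
  proof -
    have "{i. i < length I \<and> matched ds i} = {..<length I} \<inter> Collect (matched ds)" by auto
    then show ?thesis
      by (simp add: profit_def indicator_def if_distrib cong: if_cong)
  qed
  have integrable: "integrable (run tgm I) (indicator S :: _ \<Rightarrow> real)" for S
    by (rule integrable_real_indicator) (simp_all add: less_top[symmetric])
  have "1/3 * opt I = (\<Sum>i<length I. snd (I ! i) * (1/3))"
    by (simp add: opt_def sum_distrib_right)
  also have "\<dots> \<le> (\<Sum>i<length I. snd (I ! i) * measure_pmf.prob (run tgm I) {ds. matched ds i})"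
  proof (intro sum_mono mult_left_mono)
    fix i assume "i \<in> {..<length I}"
    then show "1/3 \<le> measure_pmf.prob (run tgm I) {ds. matched ds i}" "0 \<le> snd (I ! i)"
      using prob_matched valid by (auto simp: ownm_input_def less_imp_le)
  qed
  also have "\<dots> = expected_profit tgm I"
    unfolding expected_profit_def profit
    by (subst Bochner_Integration.integral_sum) (simp_all add: integrable)
  finally show ?thesis .
qed

end

theorem theorem9:
  shows "(\<forall>I i. ownm_input I \<and> i < length I \<longrightarrow>
            measure_pmf.prob (run tgm I) {ds. matched ds i} \<ge> 1/3) \<and>
         strictly_competitive (1/3) tgm"
  using tgm_run.prob_matched tgm_run.feasible_run tgm_run.expected_profit_ge
  unfolding strictly_competitive_def ownm_algorithm_def tgm_run_def by blast

end
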